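(* Let $d_1,d_3,\beta_1,\beta_3,\kappa_1,\kappa_2,\alpha_1>0$ and $\alpha_2,\alpha_3,\alpha_4\ge 0$ be constants such that $17-16d_1\ne0$, $17-40d_1\neq 0$, $1-\kappa_2\alpha_2\neq0$, $17-16d_1+\kappa_2\alpha_2^2\neq 0$, $12\alpha_1+80d_1-34\neq0$, and suppose that $$\beta_1=17-16d_1,\quad \beta_3=\frac{17-8d_3}{2},\quad \alpha_4=\frac{16d_1(17-\alpha_3)+(17+\alpha_2)\alpha_3-17(17+\kappa_2\alpha_2^2)}{(17-16d_1)(1-\kappa_2\alpha_2)},$$ $$d_3=\frac{17}{8}-\frac{17\alpha_1}{12\alpha_1+80d_1-34},\quad \kappa_1=\frac{\alpha_1}{17(17-40d_1)}\cdot\frac{391-368d_1-(289-952d_1+640d_1^2+408\alpha_2-408d_1\alpha_2)\kappa_2}{17-16d_1+\kappa_2\alpha_2^2}.$$ Then the functions $$u(t,x)=\frac{17-16d_1+\alpha_2}{68-64d_1+4\kappa_2\alpha_2^2}\left(1-\tanh\left(x-\tfrac{17}{4}t\right)\right)^2,$$ $$v(t,x)=\frac{(17-16d_1)(1-\kappa_2\alpha_2)}{68-64d_1+4\kappa_2\alpha_2^2}\left(1-\tanh\left(x-\tfrac{17}{4}t\right)\right)^2,$$ $$w(t,x)=\frac{17-40d_1}{4\alpha_1}\left(1-\tanh^2\left(x-\tfrac{17}{4}t\right)\right)$$ form an exact solution, for all $(t,x)\in\mathbb{R}^2$, of the system $$u_t = d_1u_{xx}+\beta_1u(1-u)-\alpha_1uw+\alpha_2uv,$$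 $$v_t = v_{xx}+ v(1-v)+(\kappa_1\alpha_3+\kappa_2\alpha_1)uw-(\kappa_2\alpha_2u+\kappa_1\alpha_4w)v,$$ $$w_t = d_3 w_{xx}+\beta_3w(1-w)-\alpha_3uw+\alpha_4vw.$$ *)

theory Defs
  imports "HOL-Analysis.Analysis"
begin

definition pd_t :: "(real \<Rightarrow> real \<Rightarrow> real) \<Rightarrow> real \<Rightarrow> real \<Rightarrow> real" where
  "pd_t f t x = deriv (\<lambda>s. f s x) t"

definition pd_x :: "(real \<Rightarrow> real \<Rightarrow> real) \<Rightarrow> real \<Rightarrow> real \<Rightarrow> real" where
  "pd_x f t x = deriv (\<lambda>y. f t y) x"

definition pd_xx :: "(real \<Rightarrow> real \<Rightarrow> real) \<Rightarrow> real \<Rightarrow> real \<Rightarrow> real" where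
  "pd_xx f = pd_x (pd_x f)"

text \<open>Since \<^term>\<open>deriv\<close> is a total function whose value is arbitrary where the derivative does
  not exist, being a solution must include the existence of the derivatives that occur in the
  equations.\<close>

definition has_pds :: "(real \<Rightarrow> real \<Rightarrow> real) \<Rightarrow> bool" where
  "has_pds f \<longleftrightarrow> (\<forall>t x.
     (\<lambda>s. f s x) field_differentiable (at t) \<and>
     (\<lambda>y. f t y) field_differentiable (at x) \<and>
     (\<lambda>y. pd_x f t y) field_differentiable (at x))"

end

(* With p = 1 - tanh z and q = 1 + tanh z one has p' = - p q and q' = p q, so u and v are
   multiples of p^2 and w is a multiple of p q.  After cancelling p^2 resp. p q from the three
   equations and homogenising with p + q = 2, each becomes a quadratic form in p and q, and the
   parameter conditions make its three coefficients vanish. *)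

theory Submission
  imports Defs
begin

text \<open>The chain rule reduces every partial derivative of a wave of speed \<open>c\<close> to
  ordinary derivatives of its profile. Existence and values come from the same derivative facts,
  since \<open>deriv\<close> alone would not give existence.\<close>

lemma travelling_wave_pds:
  fixes F G H :: "real \<Rightarrow> real" and c :: real
  assumes F: "\<And>z. (F has_real_derivative G z) (at z)"
    and G: "\<And>z. (G has_real_derivative H z) (at z)"
  defines "f \<equiv> \<lambda>t x. F (x - c * t)"
  shows "has_pds f" "pd_t f t x = - c * G (x - c * t)" "pd_xx f t x = H (x - c * t)"
proof -
  have ft: "((\<lambda>s. f s y) has_real_derivative (- c * G (y - c * s))) (at s)" for s y
    unfolding f_def by (rule DERIV_cong, rule DERIV_chain2[OF F]) (auto intro!: derivative_eq_intros)
  have fx: "((\<lambda>y. f s y) has_real_derivative G (y - c * s)) (at y)" for s y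
    unfolding f_def by (rule DERIV_cong, rule DERIV_chain2[OF F]) (auto intro!: derivative_eq_intros)
  have pdx: "pd_x f = (\<lambda>s y. G (y - c * s))"
    unfolding pd_x_def using DERIV_imp_deriv[OF fx] by blast
  have fxx: "((\<lambda>y. G (y - c * s)) has_real_derivative H (y - c * s)) (at y)" for s y
    by (rule DERIV_cong, rule DERIV_chain2[OF G]) (auto intro!: derivative_eq_intros)
  show "has_pds f"
    unfolding has_pds_def pdx field_differentiable_def using ft fx fxx by blast
  show "pd_t f t x = - c * G (x - c * t)"
    unfolding pd_t_def by (rule DERIV_imp_deriv[OF ft])
  show "pd_xx f t x = H (x - c * t)"
    unfolding pd_xx_def pdx unfolding pd_x_def by (rule DERIV_imp_deriv[OF fxx])
qed

text \<open>The factored form reads q' = p q for q = 1 + tanh z and p = 1 - tanh z, hence also p' =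
  - p q.\<close>

lemma has_real_derivative_tanh:
  "(tanh has_real_derivative (1 - tanh x) * (1 + tanh x)) (at (x::real))"
  by (rule DERIV_cong, rule has_field_derivative_tanh[OF _ DERIV_ident])
    (auto simp: algebra_simps power2_eq_square)

text \<open>From p' = - p q and q' = p q, the profile A p^2 has derivative - 2 A p^2 q, and
  differentiating again gives 4 A p^2 q^2 - 2 A p^3 q. The factor p^2 is kept outside so that it can
  be cancelled later.\<close>

lemma kink_wave_pds:
  fixes A c t x :: real
  defines "f \<equiv> \<lambda>t x. A * (1 - tanh (x - c * t))\<^sup>2"
    and "p \<equiv> 1 - tanh (x - c * t)" and "q \<equiv> 1 + tanh (x - c * t)"
  shows "has_pds f" "pd_t f t x = c * (2 * A * p\<^sup>2 * q)"
    "pd_xx f t x = A * p\<^sup>2 * (4 * q\<^sup>2 - 2 * p * q)"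
proof -
  have 1: "((\<lambda>z. A * (1 - tanh z)\<^sup>2) has_real_derivative
      - 2 * A * (1 - tanh z)\<^sup>2 * (1 + tanh z)) (at z)" for z
    by (rule derivative_eq_intros has_real_derivative_tanh refl)+
      (simp add: algebra_simps power2_eq_square)
  have 2: "((\<lambda>z. - 2 * A * (1 - tanh z)\<^sup>2 * (1 + tanh z)) has_real_derivative
      A * (1 - tanh z)\<^sup>2 * (4 * (1 + tanh z)\<^sup>2 - 2 * (1 - tanh z) * (1 + tanh z))) (at z)" for z
    by (rule derivative_eq_intros has_real_derivative_tanh refl)+
      (simp add: algebra_simps power2_eq_square)
  note * = travelling_wave_pds[OF 1 2]
  show "has_pds f"
    unfolding f_def by (rule *(1))
  show "pd_t f t x = c * (2 * A * p\<^sup>2 * q)"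
    unfolding f_def p_def q_def *(2) by simp
  show "pd_xx f t x = A * p\<^sup>2 * (4 * q\<^sup>2 - 2 * p * q)"
    unfolding f_def p_def q_def by (rule *(3))
qed

text \<open>The profile is C p q, and (p q)' = p q (p - q) while (p - q)' = - 2 p q.\<close>

lemma pulse_wave_pds:
  fixes C c t x :: real
  defines "f \<equiv> \<lambda>t x. C * (1 - (tanh (x - c * t))\<^sup>2)"
    and "p \<equiv> 1 - tanh (x - c * t)" and "q \<equiv> 1 + tanh (x - c * t)"
  shows "has_pds f" "pd_t f t x = - c * (C * p * q * (p - q))"
    "pd_xx f t x = C * p * q * ((p - q)\<^sup>2 - 2 * p * q)"
proof -
  have 1: "((\<lambda>z. C * (1 - (tanh z)\<^sup>2)) has_real_derivative
      - 2 * C * tanh z * (1 - (tanh z)\<^sup>2)) (at z)" for z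
    by (rule derivative_eq_intros has_real_derivative_tanh refl)+
      (simp add: algebra_simps power2_eq_square)
  \<comment> \<open>Here p - q = - 2 tanh z and p q = 1 - (tanh z)^2, so 6 (tanh z)^2 - 2 is (p -
    q)^2 - 2 p q.\<close>
  have 2: "((\<lambda>z. - 2 * C * tanh z * (1 - (tanh z)\<^sup>2)) has_real_derivative
      C * (1 - (tanh z)\<^sup>2) * (6 * (tanh z)\<^sup>2 - 2)) (at z)" for z
    by (rule derivative_eq_intros has_real_derivative_tanh refl)+
      (simp add: algebra_simps power2_eq_square)
  note * = travelling_wave_pds[OF 1 2]
  show "has_pds f"
    unfolding f_def by (rule *(1))
  show "pd_t f t x = - c * (C * p * q * (p - q))"
    unfolding f_def p_def q_def *(2) by (simp add: algebra_simps power2_eq_square)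
  show "pd_xx f t x = C * p * q * ((p - q)\<^sup>2 - 2 * p * q)"
    unfolding f_def p_def q_def *(3) by (simp add: algebra_simps power2_eq_square)
qed

theorem mainTheorem4:
  fixes d1 d3 \<beta>1 \<beta>3 \<kappa>1 \<kappa>2 \<alpha>1 \<alpha>2 \<alpha>3 \<alpha>4 :: real
    and u v w :: "real \<Rightarrow> real \<Rightarrow> real"
  assumes "d1 > 0" "d3 > 0" "\<beta>1 > 0" "\<beta>3 > 0" "\<kappa>1 > 0" "\<kappa>2 > 0" "\<alpha>1 > 0"
    and "\<alpha>2 \<ge> 0" "\<alpha>3 \<ge> 0" "\<alpha>4 \<ge> 0"
    and "17 - 16 * d1 \<noteq> 0"
    and "17 - 40 * d1 \<noteq> 0"
    and "1 - \<kappa>2 * \<alpha>2 \<noteq> 0"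
    and "17 - 16 * d1 + \<kappa>2 * \<alpha>2\<^sup>2 \<noteq> 0"
    and "12 * \<alpha>1 + 80 * d1 - 34 \<noteq> 0"
    and "\<beta>1 = 17 - 16 * d1"
    and "\<beta>3 = (17 - 8 * d3) / 2"
    and "\<alpha>4 = (16 * d1 * (17 - \<alpha>3) + (17 + \<alpha>2) * \<alpha>3 - 17 * (17 + \<kappa>2 * \<alpha>2\<^sup>2))
                / ((17 - 16 * d1) * (1 - \<kappa>2 * \<alpha>2))"
    and "d3 = 17 / 8 - 17 * \<alpha>1 / (12 * \<alpha>1 + 80 * d1 - 34)"
    and "\<kappa>1 = \<alpha>1 / (17 * (17 - 40 * d1))
              * ((391 - 368 * d1
                  - (289 - 952 * d1 + 640 * d1\<^sup>2 + 408 * \<alpha>2 - 408 * d1 * \<alpha>2) * \<kappa>2)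
                 / (17 - 16 * d1 + \<kappa>2 * \<alpha>2\<^sup>2))"
    and u: "u = (\<lambda>t x. (17 - 16 * d1 + \<alpha>2) / (68 - 64 * d1 + 4 * \<kappa>2 * \<alpha>2\<^sup>2)
                        * (1 - tanh (x - 17 / 4 * t))\<^sup>2)"
    and v: "v = (\<lambda>t x. (17 - 16 * d1) * (1 - \<kappa>2 * \<alpha>2) / (68 - 64 * d1 + 4 * \<kappa>2 * \<alpha>2\<^sup>2)
                        * (1 - tanh (x - 17 / 4 * t))\<^sup>2)"
    and w: "w = (\<lambda>t x. (17 - 40 * d1) / (4 * \<alpha>1) * (1 - (tanh (x - 17 / 4 * t))\<^sup>2))"
  shows "has_pds u \<and> has_pds v \<and> has_pds w \<and>
    (\<forall>t x.
      pd_t u t x = d1 * pd_xx u t x + \<beta>1 * u t x * (1 - u t x)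
                     - \<alpha>1 * u t x * w t x + \<alpha>2 * u t x * v t x \<and>
      pd_t v t x = pd_xx v t x + v t x * (1 - v t x)
                     + (\<kappa>1 * \<alpha>3 + \<kappa>2 * \<alpha>1) * u t x * w t x
                     - (\<kappa>2 * \<alpha>2 * u t x + \<kappa>1 * \<alpha>4 * w t x) * v t x \<and>
      pd_t w t x = d3 * pd_xx w t x + \<beta>3 * w t x * (1 - w t x)
                     - \<alpha>3 * u t x * w t x + \<alpha>4 * v t x * w t x)"
proof -
  \<comment> \<open>\<open>\<gamma>\<close> is a quarter of the common denominator of
    \<open>u\<close> and \<open>v\<close>, and \<open>\<epsilon>\<close> is the denominator in
    \<open>d3\<close>. The facts below clear these denominators, so that only polynomial identities
    remain.\<close>
  define \<gamma> where "\<gamma> = 17 - 16 * d1 + \<kappa>2 * \<alpha>2\<^sup>2"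
  define \<epsilon> where "\<epsilon> = 12 * \<alpha>1 + 80 * d1 - 34"
  define A where "A = (17 - 16 * d1 + \<alpha>2) / (4 * \<gamma>)"
  define B where "B = (17 - 16 * d1) * (1 - \<kappa>2 * \<alpha>2) / (4 * \<gamma>)"
  define C where "C = (17 - 40 * d1) / (4 * \<alpha>1)"
  note b1 = \<open>\<beta>1 = 17 - 16 * d1\<close> and b3 = \<open>\<beta>3 = (17 - 8 * d3) / 2\<close>
  have ne: "\<gamma> \<noteq> 0" "\<epsilon> \<noteq> 0" "\<alpha>1 \<noteq> 0" "17 - 40 * d1 \<noteq> 0" "17 - 16 * d1 \<noteq> 0" "1 - \<kappa>2 * \<alpha>2 \<noteq> 0"
    using assms by (auto simp: \<gamma>_def \<epsilon>_def)
  have A: "4 * \<gamma> * A = 17 - 16 * d1 + \<alpha>2"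
    and B: "4 * \<gamma> * B = (17 - 16 * d1) * (1 - \<kappa>2 * \<alpha>2)"
    and C: "4 * \<alpha>1 * C = 17 - 40 * d1"
    using ne by (auto simp: A_def B_def C_def)
  \<comment> \<open>Regrouped so that both sides match the numerators of \<open>A\<close> and
    \<open>B\<close>: this is \<open>w_pp\<close> multiplied by \<open>\<gamma>\<close>.\<close>
  have a4: "\<alpha>4 * ((17 - 16 * d1) * (1 - \<kappa>2 * \<alpha>2)) =
      \<alpha>3 * (17 - 16 * d1 + \<alpha>2) - 17 * \<gamma>"
  proof -
    have "\<alpha>4 * ((17 - 16 * d1) * (1 - \<kappa>2 * \<alpha>2)) =
        16 * d1 * (17 - \<alpha>3) + (17 + \<alpha>2) * \<alpha>3 - 17 * (17 + \<kappa>2 * \<alpha>2\<^sup>2)"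
      unfolding \<open>\<alpha>4 = _\<close> using ne by simp
    then show ?thesis
      by (simp add: \<gamma>_def algebra_simps)
  qed
  have k1: "17 * (17 - 40 * d1) * \<gamma> * \<kappa>1 = \<alpha>1 * (391 - 368 * d1
      - (289 - 952 * d1 + 640 * d1\<^sup>2 + 408 * \<alpha>2 - 408 * d1 * \<alpha>2) * \<kappa>2)"
    unfolding \<open>\<kappa>1 = _\<close> \<gamma>_def[symmetric] using ne by simp
  have d3: "8 * \<epsilon> * d3 = 17 * \<epsilon> - 136 * \<alpha>1"
    unfolding \<open>d3 = _\<close> \<epsilon>_def[symmetric] using ne by (simp add: field_simps)
  \<comment> \<open>The suffixes \<open>pp\<close> and \<open>pq\<close> mean the coefficients of
    p^2 and p q in the cancelled, homogenised equation for the named function; each such fact says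
    that the coefficient vanishes.\<close>
  have u_pp: "4 * (\<beta>1 * A - \<alpha>2 * B) = \<beta>1"
  proof -
    have "\<gamma> * (4 * (\<beta>1 * A - \<alpha>2 * B)) = \<beta>1 * (4 * \<gamma> * A) - \<alpha>2 * (4 * \<gamma> * B)"
      by (simp add: algebra_simps)
    also have "\<dots> = \<gamma> * \<beta>1"
      unfolding A B b1 unfolding \<gamma>_def by (simp add: algebra_simps power2_eq_square)
    finally show ?thesis using ne by simp
  qed
  have v_pp: "4 * (B + \<kappa>2 * \<alpha>2 * A) = 1"
  proof -
    have "\<gamma> * (4 * (B + \<kappa>2 * \<alpha>2 * A)) = 4 * \<gamma> * B + \<kappa>2 * \<alpha>2 * (4 * \<gamma> * A)"
      by (simp add: algebra_simps)
    also have "\<dots> = \<gamma> * 1"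
      unfolding A B unfolding \<gamma>_def by (simp add: algebra_simps power2_eq_square)
    finally show ?thesis using ne by simp
  qed
  have w_pp: "4 * (\<alpha>3 * A - \<alpha>4 * B) = 17"
  proof -
    have "\<gamma> * (4 * (\<alpha>3 * A - \<alpha>4 * B)) = \<alpha>3 * (4 * \<gamma> * A) - \<alpha>4 * (4 * \<gamma> * B)"
      by (simp add: algebra_simps)
    also have "\<dots> = \<gamma> * 17"
      unfolding A B a4 by (simp add: algebra_simps)
    finally show ?thesis using ne by simp
  qed
  \<comment> \<open>The number 23 collects the p q terms with factor B: - 2 from diffusion, 1/2 from
    the constant 1 = (p + q)^2 / 4 and - 17/4 from the wave speed add up to - 23/4.\<close>
  have v_pq: "4 * C * ((\<kappa>1 * \<alpha>3 + \<kappa>2 * \<alpha>1) * A - \<kappa>1 * \<alpha>4 * B) = 23 * B"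
  proof -
    \<comment> \<open>Grouping the \<kappa>1 terms exposes \<alpha>3 A - \<alpha>4 B, which
      \<open>w_pp\<close> evaluates; this yields exactly the left side of \<open>k1\<close>.
      Afterwards 391 - 368 d1 = 23 (17 - 16 d1) produces \<open>B\<close>.\<close>
    have "(4 * \<alpha>1 * \<gamma>) * (4 * C * ((\<kappa>1 * \<alpha>3 + \<kappa>2 * \<alpha>1) * A - \<kappa>1 * \<alpha>4 * B)) =
        (4 * \<alpha>1 * C) * (\<gamma> * \<kappa>1 * (4 * (\<alpha>3 * A - \<alpha>4 * B)) + \<kappa>2 * \<alpha>1 * (4 * \<gamma> * A))"
      by (simp add: algebra_simps)
    also have "\<dots> = 17 * (17 - 40 * d1) * \<gamma> * \<kappa>1
        + \<alpha>1 * \<kappa>2 * (17 - 40 * d1) * (17 - 16 * d1 + \<alpha>2)"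
      unfolding A C w_pp by (simp add: algebra_simps)
    also have "\<dots> = \<alpha>1 * 23 * (4 * \<gamma> * B)"
      unfolding k1 B by (simp add: algebra_simps power2_eq_square)
    also have "\<dots> = (4 * \<alpha>1 * \<gamma>) * (23 * B)"
      by (simp add: algebra_simps)
    finally show ?thesis using ne by simp
  qed
  have w_pq: "8 * d3 = \<beta>3 * (1 - 2 * C)"
  proof -
    \<comment> \<open>The formula for \<open>d3\<close> says 17 - 8 d3 = 136 \<alpha>1 / \<epsilon>,
      and \<beta>3 is half of this.\<close>
    have b3': "\<epsilon> * \<beta>3 = 68 * \<alpha>1"
      unfolding b3 using d3 by (simp add: algebra_simps)
    have "\<epsilon> * (\<beta>3 * (1 - 2 * C)) = (\<epsilon> * \<beta>3) * (1 - 2 * C)"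
      by simp
    also have "\<dots> = 68 * \<alpha>1 - 34 * (4 * \<alpha>1 * C)"
      unfolding b3' by (simp add: algebra_simps)
    also have "\<dots> = \<epsilon> * (8 * d3)"
      unfolding C using d3 by (simp add: \<epsilon>_def algebra_simps)
    finally show ?thesis using ne by simp
  qed
  have u': "u = (\<lambda>t x. A * (1 - tanh (x - 17 / 4 * t))\<^sup>2)"
    and v': "v = (\<lambda>t x. B * (1 - tanh (x - 17 / 4 * t))\<^sup>2)"
    and w': "w = (\<lambda>t x. C * (1 - (tanh (x - 17 / 4 * t))\<^sup>2))"
    unfolding u v w A_def B_def C_def \<gamma>_def by (simp_all add: algebra_simps)
  note u_pds = kink_wave_pds[where A = A and c = "17 / 4", folded u']
    and v_pds = kink_wave_pds[where A = B and c = "17 / 4", folded v']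
    and w_pds = pulse_wave_pds[where C = C and c = "17 / 4", folded w']
  have eqs:
    "pd_t u t x = d1 * pd_xx u t x + \<beta>1 * u t x * (1 - u t x)
      - \<alpha>1 * u t x * w t x + \<alpha>2 * u t x * v t x \<and>
     pd_t v t x = pd_xx v t x + v t x * (1 - v t x)
      + (\<kappa>1 * \<alpha>3 + \<kappa>2 * \<alpha>1) * u t x * w t x
      - (\<kappa>2 * \<alpha>2 * u t x + \<kappa>1 * \<alpha>4 * w t x) * v t x \<and>
     pd_t w t x = d3 * pd_xx w t x + \<beta>3 * w t x * (1 - w t x)
      - \<alpha>3 * u t x * w t x + \<alpha>4 * v t x * w t x" for t x
  proof -
    define p where "p = 1 - tanh (x - 17 / 4 * t)"
    define q where "q = 1 + tanh (x - 17 / 4 * t)"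
    \<comment> \<open>Substituting for q replaces explicit homogenisation: each bracket below
      becomes a polynomial in p that cancels identically.\<close>
    have q: "q = 2 - p"
      by (simp add: p_def q_def)
    have vals: "u t x = A * p\<^sup>2" "v t x = B * p\<^sup>2" "w t x = C * p * q"
      unfolding u' v' w' p_def q_def by (simp_all add: algebra_simps power2_eq_square)
    note ders = u_pds(2,3)[of t x, folded p_def q_def] v_pds(2,3)[of t x, folded p_def q_def]
      w_pds(2,3)[of t x, folded p_def q_def]
    \<comment> \<open>The factors 4 and / 4 on the right make the left sides of \<open>C\<close> and
      \<open>u_pp\<close> occur literally, ready for rewriting. These settle p q and p^2; the q^2
      coefficient 4 d1 + \<beta>1 / 4 - 17/4 vanishes by \<open>b1\<close>.\<close>
    have "d1 * (A * p\<^sup>2 * (4 * q\<^sup>2 - 2 * p * q)) + \<beta>1 * (A * p\<^sup>2) * (1 - A * p\<^sup>2)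
        - \<alpha>1 * (A * p\<^sup>2) * (C * p * q) + \<alpha>2 * (A * p\<^sup>2) * (B * p\<^sup>2)
        - 17 / 4 * (2 * A * p\<^sup>2 * q)
      = A * p\<^sup>2 * (d1 * (4 * q\<^sup>2 - 2 * p * q) + \<beta>1
        - 4 * \<alpha>1 * C * p * q / 4 - 4 * (\<beta>1 * A - \<alpha>2 * B) * p\<^sup>2 / 4 - 17 / 2 * q)"
      by (simp add: field_simps)
    also have "\<dots> = 0"
      unfolding u_pp C unfolding b1 q by (simp add: field_simps power2_eq_square)
    finally have 1: "17 / 4 * (2 * A * p\<^sup>2 * q) =
      d1 * (A * p\<^sup>2 * (4 * q\<^sup>2 - 2 * p * q)) + \<beta>1 * (A * p\<^sup>2) * (1 - A * p\<^sup>2)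
        - \<alpha>1 * (A * p\<^sup>2) * (C * p * q) + \<alpha>2 * (A * p\<^sup>2) * (B * p\<^sup>2)"
      by simp
    \<comment> \<open>Only p^2 is cancelled, because the production term in u w carries no factor B.
      The q^2 coefficient is B (4 + 1/4 - 17/4) = 0, which reflects the speed 17/4.\<close>
    have "B * p\<^sup>2 * (4 * q\<^sup>2 - 2 * p * q) + B * p\<^sup>2 * (1 - B * p\<^sup>2)
        + (\<kappa>1 * \<alpha>3 + \<kappa>2 * \<alpha>1) * (A * p\<^sup>2) * (C * p * q)
        - (\<kappa>2 * \<alpha>2 * (A * p\<^sup>2) + \<kappa>1 * \<alpha>4 * (C * p * q)) * (B * p\<^sup>2)
        - 17 / 4 * (2 * B * p\<^sup>2 * q)
      = p\<^sup>2 * (B * (4 * q\<^sup>2 - 2 * p * q + 1 - 4 * (B + \<kappa>2 * \<alpha>2 * A) * p\<^sup>2 / 4 - 17 / 2 * q)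
        + 4 * C * ((\<kappa>1 * \<alpha>3 + \<kappa>2 * \<alpha>1) * A - \<kappa>1 * \<alpha>4 * B) * p * q / 4)"
      by (simp add: field_simps)
    also have "\<dots> = 0"
      unfolding v_pp v_pq q by (simp add: field_simps power2_eq_square)
    finally have 2: "17 / 4 * (2 * B * p\<^sup>2 * q) =
      B * p\<^sup>2 * (4 * q\<^sup>2 - 2 * p * q) + B * p\<^sup>2 * (1 - B * p\<^sup>2)
        + (\<kappa>1 * \<alpha>3 + \<kappa>2 * \<alpha>1) * (A * p\<^sup>2) * (C * p * q)
        - (\<kappa>2 * \<alpha>2 * (A * p\<^sup>2) + \<kappa>1 * \<alpha>4 * (C * p * q)) * (B * p\<^sup>2)"
      by simp
    \<comment> \<open>Splitting 1 - C p q as (1 - p q / 2) + (1 - 2 C) p q / 2 brings out the right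
      side of \<open>w_pq\<close>. The q^2 coefficient d3 + \<beta>3 / 4 - 17/8 vanishes by
      \<open>b3\<close>.\<close>
    have "d3 * (C * p * q * ((p - q)\<^sup>2 - 2 * p * q)) + \<beta>3 * (C * p * q) * (1 - C * p * q)
        - \<alpha>3 * (A * p\<^sup>2) * (C * p * q) + \<alpha>4 * (B * p\<^sup>2) * (C * p * q)
        + 17 / 4 * (C * p * q * (p - q))
      = C * p * q * (d3 * ((p - q)\<^sup>2 - 2 * p * q) + \<beta>3 * (1 - p * q / 2)
        + \<beta>3 * (1 - 2 * C) * (p * q) / 2
        - 4 * (\<alpha>3 * A - \<alpha>4 * B) * p\<^sup>2 / 4 + 17 / 4 * (p - q))"
      by (simp add: field_simps)
    also have "\<dots> = 0"
      unfolding w_pp w_pq[symmetric] unfolding b3 q by (simp add: field_simps power2_eq_square)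
    finally have 3: "- (17 / 4) * (C * p * q * (p - q)) =
      d3 * (C * p * q * ((p - q)\<^sup>2 - 2 * p * q)) + \<beta>3 * (C * p * q) * (1 - C * p * q)
        - \<alpha>3 * (A * p\<^sup>2) * (C * p * q) + \<alpha>4 * (B * p\<^sup>2) * (C * p * q)"
      by simp
    show ?thesis
      unfolding vals ders using 1 2 3 by blast
  qed
  show ?thesis
    using u_pds(1) v_pds(1) w_pds(1) eqs by blast
qed

end
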